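(* Let $f:\mathbb{R}\to\mathbb{R}$ be locally Lipschitz continuous, increasing and odd, with $f(0)=0$ and $xf(x)>0$ for all $x\neq 0$. Suppose that there exists $\epsilon_0\in(0,1)$ such that for every $\epsilon\in(0,\epsilon_0)$ $$\underline{\Phi}_f(\epsilon):=\liminf_{x\to 0^+}\frac{f((1-\epsilon)x)}{f(x)}>0,\qquad\text{and}\quad \underline{\Phi}_f(\epsilon)\to 1\ \text{ as } \epsilon\to 0^+,$$ and that $$\limsup_{x\to 0^+}\frac{f(\mu x)}{f(x)}<\mu\quad\text{for all }\mu\in(0,1).$$ Let $g:[0,\infty)\to\mathbb{R}$ be continuous, let $\xi\in\mathbb{R}$, and let $x$ be the continuous solution on $[0,\infty)$ of $x'(t)=-f(x(t))+g(t)$, $t>0$, $x(0)=\xi$. Suppose that $x(t)\to 0$ as $t\to\infty$. Then the following statements are equivalent: (a) $\lim_{t\to\infty}\int_0^t g(s)\,ds$ exists (and is finite), and $\int_t^\infty g(s)\,ds=O(F^{-1}(t))$ as $t\to\infty$; (b) $x(t)=O(F^{-1}(t))$ as $t\to\infty$.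
   Context: $F:(0,\infty)\to\mathbb{R}$ is defined by $F(x)=\int_x^1 \frac{1}{f(u)}\,du$. It is strictly decreasing, and $F^{-1}$ denotes its inverse function. Under the stated hypotheses $F(x)\to+\infty$ as $x\to0^+$, so $F^{-1}(t)$ is defined for all $t\ge 0$. The integral $\int_t^\infty g(s)\,ds$ is understood as the improper integral $\lim_{T\to\infty}\int_t^T g(s)\,ds$. *)

theory Defs
  imports "HOL-Analysis.Analysis" "HOL-Library.Landau_Symbols"
begin

definition Phi_lower :: "(real \<Rightarrow> real) \<Rightarrow> real \<Rightarrow> ereal" where
  "Phi_lower f \<epsilon> = Liminf (at_right 0) (\<lambda>x. ereal (f ((1 - \<epsilon>) * x) / f x))"

(* The interval integral is oriented, so F_fun f x is negative for x > 1 (when f > 0). *)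
definition F_fun :: "(real \<Rightarrow> real) \<Rightarrow> real \<Rightarrow> real" where
  "F_fun f x = (LBINT u=ereal x..ereal 1. 1 / f u)"

(* The inverse of F_fun f as a function on (0, \<infinity>); meaningful on the image of (0, \<infinity>). *)
definition F_inv :: "(real \<Rightarrow> real) \<Rightarrow> real \<Rightarrow> real" where
  "F_inv f = inv_into {0<..} (F_fun f)"

(* The limit of the integrals over [t, T] as T tends to infinity; it need not be absolutely
   convergent, so this is not the Lebesgue integral over [t, \<infinity>).
   Unspecified if the limit does not exist. *)
definition improper_integral_from :: "(real \<Rightarrow> real) \<Rightarrow> real \<Rightarrow> real" where
  "improper_integral_from g t = Lim at_top (\<lambda>T. LBINT s=ereal t..ereal T. g s)"

end

theory Submission imports Defs begin

text \<open>Write \<open>\<phi>\<close> for the inverse of \<open>F\<close>, so that \<open>\<phi>' = - f \<circ> \<phi>\<close>.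

If \<open>\<bar>x\<bar> \<le> K \<phi>\<close>, then the hypothesis on \<open>\<Phi>\<close>, iterated, gives \<open>\<bar>f \<circ> x\<bar> \<le> C f \<circ> \<phi> = - C \<phi>'\<close>, which integrates to a tail
bound by \<open>C \<phi>\<close>; the integral of \<open>g\<close> is recovered from the equation.

Conversely, with \<open>G\<close> the tail integral of \<open>g\<close> and \<open>\<bar>G\<bar> \<le> K \<phi>\<close>, the function \<open>z = x + G\<close> solves \<open>z' = - f (z - G)\<close>.
Since \<open>f\<close> grows superlinearly under dilation near \<open>0\<close>, there is an \<open>M > K\<close> with \<open>f ((M - K) y) > M f y\<close> for small \<open>y\<close>,
which makes \<open>t \<mapsto> M \<phi> (t - S)\<close> a strict supersolution. The delay \<open>S\<close> only costs a constant factor because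
\<open>f y = O(y)\<close>. The lower bound follows by oddness.\<close>

section \<open>A crossing argument and tail integrals\<close>

text \<open>At a first zero \<open>c\<close>, a negative derivative would make \<open>u\<close>
  positive just before \<open>c\<close>, where it is still negative. The derivative is constrained
  only at zeros, so a barrier need be checked only at points of contact.\<close>

lemma first_crossing:
  fixes u :: "real \<Rightarrow> real"
  assumes cont: "continuous_on {a..} u" and "u a < 0"
    and deriv: "\<And>t. t > a \<Longrightarrow> u t = 0 \<Longrightarrow> \<exists>D<0. (u has_real_derivative D) (at t)"
    and "b \<ge> a"
  shows "u b < 0"
proof (rule ccontr)
  assume "\<not> u b < 0"
  let ?A = "{a..b} \<inter> u -` {0..}"
  have cont': "continuous_on {a..b} u" using cont continuous_on_subset by fastforce
  have "compact ?A"
    using continuous_closed_preimage[OF cont', of "{0..}"]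
    by (auto simp: compact_eq_bounded_closed intro: bounded_Int)
  moreover have "b \<in> ?A" using \<open>\<not> u b < 0\<close> \<open>b \<ge> a\<close> by auto
  ultimately obtain c where c: "c \<in> ?A" "\<And>s. s \<in> ?A \<Longrightarrow> c \<le> s"
    using compact_attains_inf[of ?A] by blast
  have ca: "a < c" using c(1) \<open>u a < 0\<close> by (cases "a = c") auto
  have neg: "u s < 0" if "a \<le> s" "s < c" for s
    using c(2)[of s] c(1) that by fastforce
  have "u c = 0"
  proof (rule ccontr)
    assume "u c \<noteq> 0"
    then have "u c > 0" using c(1) by auto
    then obtain s where "a \<le> s" "s \<le> c" "u s = 0"
      using IVT'[of u a 0 c] \<open>u a < 0\<close> ca continuous_on_subset[OF cont] by fastforce
    then show False using neg[of s] \<open>u c \<noteq> 0\<close> by (cases "s = c") auto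
  qed
  then obtain D where D: "D < 0" "(u has_real_derivative D) (at c)"
    using deriv ca by blast
  obtain h where h: "h > 0" "\<And>k. 0 < k \<Longrightarrow> k < h \<Longrightarrow> u c < u (c - k)"
    using DERIV_neg_dec_left[OF D(2,1)] by blast
  \<comment> \<open>The step is below \<open>h\<close>, so the local decrease applies, and at most
    \<open>c - a\<close>, so the point does not leave the interval.\<close>
  have "u (c - min (h / 2) (c - a)) > 0"
    using h(2)[of "min (h / 2) (c - a)"] h(1) ca \<open>u c = 0\<close> by auto
  moreover have "a \<le> c - min (h / 2) (c - a)" "c - min (h / 2) (c - a) < c"
    using h(1) ca by linarith+
  ultimately show False using neg by force
qed

lemma integral_deriv:
  assumes "continuous_on {0..} g" "t > 0"
  shows "((\<lambda>t. LBINT s=ereal 0..ereal t. g s) has_real_derivative g t) (at t)"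
proof -
  have "((\<lambda>t. LBINT s=ereal 0..ereal t. g s) has_vector_derivative g t) (at t within {0..t + 1})"
    by (rule interval_integral_FTC2)
      (use assms in \<open>auto intro: continuous_on_subset\<close>)
  moreover have "at t within {0..t + 1} = at t"
    by (rule at_within_interior) (use assms in auto)
  ultimately show ?thesis
    by (simp add: has_real_derivative_iff_has_vector_derivative)
qed

text \<open>Split the integral over [0, T] at \<open>t\<close> and let T tend to infinity. This
  trades the \<open>Lim\<close> in the definition for an expression that can be differentiated in
  \<open>t\<close>.\<close>

lemma improper_integral_from_eq:
  assumes g: "continuous_on {0..} g"
    and L: "((\<lambda>t. LBINT s=ereal 0..ereal t. g s) \<longlongrightarrow> L) at_top" and "t \<ge> 0"
  shows "improper_integral_from g t = L - (LBINT s=ereal 0..ereal t. g s)"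
  unfolding improper_integral_from_def
proof (rule tendsto_Lim)
  let ?H = "\<lambda>t. LBINT s=ereal 0..ereal t. g s"
  have "\<forall>\<^sub>F T in at_top. ?H T - ?H t = (LBINT s=ereal t..ereal T. g s)"
  proof (rule eventually_at_top_linorderI[of t])
    fix T assume "t \<le> T"
    have "interval_lebesgue_integrable lborel (ereal 0) (ereal T) g"
      using g \<open>t \<ge> 0\<close> \<open>t \<le> T\<close>
      by (intro interval_integrable_continuous_on) (auto intro: continuous_on_subset)
    then have "?H t + (LBINT s=ereal t..ereal T. g s) = ?H T"
      using \<open>t \<ge> 0\<close> \<open>t \<le> T\<close> by (intro interval_integral_sum) (simp add: min_def max_def zero_ereal_def)
    then show "?H T - ?H t = (LBINT s=ereal t..ereal T. g s)" by simp
  qed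
  then show "((\<lambda>T. LBINT s=ereal t..ereal T. g s) \<longlongrightarrow> L - ?H t) at_top"
    using tendsto_diff[OF L tendsto_const] by (rule Lim_transform_eventually[rotated])
qed simp

section \<open>The damping function near zero\<close>

locale damping =
  fixes f :: "real \<Rightarrow> real"
  assumes lipschitz: "local_lipschitz (UNIV :: real set) UNIV (\<lambda>_. f)"
    and mono: "mono f"
    and odd: "\<And>y. f (- y) = - f y"
    and pos: "\<And>y. y > 0 \<Longrightarrow> f y > 0"
begin

lemma at_zero: "f 0 = 0"
  using odd[of 0] by simp

lemma abs_eq: "\<bar>f y\<bar> = f \<bar>y\<bar>"
  using pos[of y] pos[of "- y"] odd[of y] at_zero by (cases y "0 :: real" rule: linorder_cases) auto

lemma continuous: "continuous_on A f"
  using local_lipschitz_continuous_on[OF lipschitz, of 0] continuous_on_subset by blast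

text \<open>A Lipschitz constant near 0 together with \<open>f 0 = 0\<close> gives the bound. It is
  what makes \<open>F\<close> diverge at 0 and a time delay harmless.\<close>

lemma linear_bound: "\<exists>u>0. \<exists>L>0. \<forall>y. 0 < y \<and> y < u \<longrightarrow> f y \<le> L * y"
proof -
  obtain u L where u: "u > 0" "\<And>s :: real. s \<in> cball 0 u \<inter> UNIV \<Longrightarrow> L-lipschitz_on (cball 0 u \<inter> UNIV) f"
    using local_lipschitzE[OF lipschitz, of 0 0] by auto
  have L: "L-lipschitz_on (cball 0 u) f"
    using u(2)[of 0] u(1) by simp
  have "f y \<le> (\<bar>L\<bar> + 1) * y" if "0 < y" "y < u" for y
  proof -
    have "dist (f y) (f 0) \<le> L * dist y 0"
      by (rule lipschitz_onD[OF L]) (use that in auto)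
    then have "f y \<le> L * y"
      using that at_zero by (simp add: dist_real_def)
    also have "\<dots> \<le> (\<bar>L\<bar> + 1) * y"
      using that by (intro mult_right_mono) auto
    finally show ?thesis .
  qed
  moreover have "\<bar>L\<bar> + 1 > 0" by simp
  ultimately show ?thesis using u(1) by blast
qed

section \<open>The function \<open>F\<close> and its inverse\<close>

lemma F_deriv:
  assumes "y > 0"
  shows "(F_fun f has_real_derivative - (1 / f y)) (at y)"
proof -
  \<comment> \<open>This interval lies in the positive axis and has both 1 and \<open>y\<close> in
    its interior, on whichever side of 1 the point \<open>y\<close> lies.\<close>
  let ?a = "min y 1 / 2" and ?b = "max y 1 + 1"
  have c: "continuous_on {?a..?b} (\<lambda>u. 1 / f u)"
  proof (intro continuous_intros continuous ballI)
    fix u assume "u \<in> {?a..?b}"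
    then have "u > 0" using assms by auto
    then show "f u \<noteq> 0" using pos[of u] by simp
  qed
  have "((\<lambda>u. LBINT v=ereal 1..ereal u. 1 / f v) has_vector_derivative 1 / f y) (at y within {?a..?b})"
    by (rule interval_integral_FTC2[OF _ _ c]) (use assms in auto)
  moreover have "at y within {?a..?b} = at y"
    by (rule at_within_interior) (use assms in auto)
  ultimately have "((\<lambda>u. LBINT v=ereal 1..ereal u. 1 / f v) has_real_derivative 1 / f y) (at y)"
    by (simp add: has_real_derivative_iff_has_vector_derivative)
  from DERIV_minus[OF this] show ?thesis
    unfolding F_fun_def by (subst interval_integral_endpoints_reverse)
qed

lemma F_one: "F_fun f 1 = 0"
  by (simp add: F_fun_def)

lemma F_strict_decreasing:
  assumes "0 < a" "a < b"
  shows "F_fun f b < F_fun f a"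
proof (rule DERIV_neg_imp_decreasing[OF assms(2)])
  fix y assume "a \<le> y" "y \<le> b"
  then have "y > 0" using assms by simp
  then show "\<exists>D. (F_fun f has_real_derivative D) (at y) \<and> D < 0"
    using F_deriv pos by (intro exI[of _ "- (1 / f y)"]) auto
qed

lemma F_inj: "inj_on (F_fun f) {0<..}"
proof (rule inj_onI)
  fix a b assume "a \<in> {0<..}" "b \<in> {0<..}" "F_fun f a = F_fun f b"
  then show "a = b"
    using F_strict_decreasing[of a b] F_strict_decreasing[of b a]
    by (cases a b rule: linorder_cases) auto
qed

text \<open>Near 0 the linear bound on \<open>f\<close> gives 1 / f(y) \<ge> 1 / (L y), so L F + ln
  is nonincreasing there. This yields both the divergence of \<open>F\<close> at 0 and the control
  of \<phi> under delays.\<close>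

lemma F_log_growth: "\<exists>u>0. \<exists>L>0. \<forall>a b. 0 < a \<and> a \<le> b \<and> b < u \<longrightarrow> ln b - ln a \<le> L * (F_fun f a - F_fun f b)"
proof -
  obtain u L where u: "u > 0" and L: "L > 0" and fL: "\<And>y. 0 < y \<Longrightarrow> y < u \<Longrightarrow> f y \<le> L * y"
    using linear_bound by blast
  have "ln b - ln a \<le> L * (F_fun f a - F_fun f b)" if "0 < a" "a \<le> b" "b < u" for a b
  proof -
    have "L * F_fun f a + ln a \<ge> L * F_fun f b + ln b"
    proof (rule DERIV_nonpos_imp_nonincreasing[OF that(2)])
      fix y assume "a \<le> y" "y \<le> b"
      then have y: "0 < y" "y < u" using that by auto
      have "((\<lambda>y. L * F_fun f y + ln y) has_real_derivative L * (- (1 / f y)) + 1 / y) (at y)"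
        using F_deriv[OF y(1)] y(1) by (auto intro!: derivative_eq_intros)
      moreover have "L * (- (1 / f y)) + 1 / y \<le> 0"
        using fL[OF y] pos[OF y(1)] y by (simp add: field_simps)
      ultimately show "\<exists>D. ((\<lambda>y. L * F_fun f y + ln y) has_real_derivative D) (at y) \<and> D \<le> 0"
        by blast
    qed
    then show ?thesis by (simp add: algebra_simps)
  qed
  with u L show ?thesis by blast
qed

lemma F_surj:
  assumes "t \<ge> 0"
  shows "\<exists>y>0. F_fun f y = t"
proof -
  obtain u L where u: "u > 0" and L: "L > 0"
    and FL: "\<And>a b. 0 < a \<Longrightarrow> a \<le> b \<Longrightarrow> b < u \<Longrightarrow> ln b - ln a \<le> L * (F_fun f a - F_fun f b)"
    using F_log_growth by blast
  \<comment> \<open>\<open>b\<close> lies in the range of the logarithmic bound and below 1, where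
    \<open>F\<close> is positive. Then \<open>a\<close> is placed so that
    \<open>ln b - ln a = L * t\<close>, which forces \<open>F\<close> to reach \<open>t\<close>
    between \<open>a\<close> and 1.\<close>
  define b where "b = min (u / 2) (1 / 2)"
  define a where "a = b * exp (- (L * t))"
  have b: "0 < b" "b < u" "b < 1" using u by (auto simp: b_def)
  have a: "0 < a" "a \<le> b" using b L assms by (auto simp: a_def mult_le_cancel_left1)
  have "ln b - ln a = L * t" using b by (simp add: a_def ln_mult)
  then have "L * t \<le> L * (F_fun f a - F_fun f b)" using FL[of a b] a b by simp
  moreover have "F_fun f b > 0" using F_strict_decreasing[of b 1] b F_one by simp
  ultimately have "t \<le> F_fun f a" using L by simp
  then have "\<exists>y\<ge>a. y \<le> 1 \<and> F_fun f y = t"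
  proof (intro IVT2)
    show "F_fun f 1 \<le> t" "a \<le> 1"
      using assms F_one a b by auto
    show "\<forall>y. a \<le> y \<and> y \<le> 1 \<longrightarrow> isCont (F_fun f) y"
      using a by (auto intro!: DERIV_isCont F_deriv)
  qed
  then obtain y where "a \<le> y" "F_fun f y = t" by blast
  then show ?thesis using a by (intro exI[of _ y]) simp
qed

lemma F_inv_F: "y > 0 \<Longrightarrow> F_inv f (F_fun f y) = y"
  unfolding F_inv_def by (rule inv_into_f_f[OF F_inj]) simp

lemma
  assumes "t \<ge> 0"
  shows F_inv_pos: "F_inv f t > 0" and F_F_inv: "F_fun f (F_inv f t) = t"
  using F_surj[OF assms] F_inv_F by auto

lemma F_inv_less:
  assumes "0 \<le> t" "y > 0" "F_fun f y < t"
  shows "F_inv f t < y"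
  using F_strict_decreasing[of y "F_inv f t"] F_F_inv[of t] assms
  by (cases y "F_inv f t" rule: linorder_cases) auto

lemma F_inv_antimono:
  assumes "0 \<le> s" "s \<le> t"
  shows "F_inv f t \<le> F_inv f s"
proof (cases "s = t")
  case False
  then have "F_inv f t < F_inv f s"
    using F_inv_pos[of s] F_F_inv[of s] assms by (intro F_inv_less) auto
  then show ?thesis by simp
qed simp

lemma F_inv_deriv:
  assumes "t > 0"
  shows "(F_inv f has_real_derivative - f (F_inv f t)) (at t)"
proof -
  let ?y = "F_inv f t"
  have y: "?y > 0" "F_fun f ?y = t" using F_inv_pos F_F_inv assms by auto
  have "isCont (F_inv f) (F_fun f ?y)"
  proof (rule isCont_inverse_function[where f = "F_fun f" and g = "F_inv f" and x = ?y and d = "?y / 2"])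
    show "0 < ?y / 2" using y by simp
    fix z assume "\<bar>z - ?y\<bar> \<le> ?y / 2"
    then have "z > 0" using y(1) by argo
    then show "F_inv f (F_fun f z) = z" "isCont (F_fun f) z"
      using F_inv_F F_deriv DERIV_isCont by blast+
  qed
  then have "(F_inv f has_real_derivative inverse (- (1 / f ?y))) (at t)"
    using assms F_deriv[OF y(1)] pos[OF y(1)] F_F_inv y(2)
    by (intro DERIV_inverse_function[where f = "F_fun f" and a = 0 and b = "t + 1"]) auto
  then show ?thesis by (simp add: field_simps)
qed

lemma F_inv_tendsto: "(F_inv f \<longlongrightarrow> 0) at_top"
proof (rule order_tendstoI)
  fix a :: real assume "a < 0"
  then show "\<forall>\<^sub>F t in at_top. a < F_inv f t"
    using F_inv_pos by (intro eventually_at_top_linorderI[of 0]) (metis less_trans)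
next
  fix a :: real assume "0 < a"
  then show "\<forall>\<^sub>F t in at_top. F_inv f t < a"
    using F_inv_less[of _ a] by (intro eventually_at_top_linorderI[of "max 0 (F_fun f a + 1)"]) auto
qed

text \<open>Between \<phi>(t) and \<phi>(t - S) the function \<open>F\<close> changes by exactly
  \<open>S\<close>, so the logarithms of these values differ by at most \<open>L * S\<close>;
  exponentiating gives the factor \<open>exp (L * S)\<close>.\<close>

lemma F_inv_shift:
  assumes "S \<ge> 0"
  shows "\<exists>C\<ge>0. \<forall>\<^sub>F t in at_top. F_inv f (t - S) \<le> C * F_inv f t"
proof -
  obtain u L where u: "u > 0" and L: "L > 0"
    and FL: "\<And>a b. 0 < a \<Longrightarrow> a \<le> b \<Longrightarrow> b < u \<Longrightarrow> ln b - ln a \<le> L * (F_fun f a - F_fun f b)"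
    using F_log_growth by blast
  have "\<forall>\<^sub>F t in at_top. F_inv f t < u"
    using F_inv_tendsto u by (rule order_tendstoD)
  then obtain T where T: "\<And>t. t \<ge> T \<Longrightarrow> F_inv f t < u"
    by (auto simp: eventually_at_top_linorder)
  have "F_inv f (t - S) \<le> exp (L * S) * F_inv f t" if t: "t \<ge> max (T + S) S" for t
  proof -
    let ?a = "F_inv f t" and ?b = "F_inv f (t - S)"
    have ts: "t - S \<ge> 0" "t \<ge> 0" "t - S \<ge> T" using t assms by auto
    have ab: "?a > 0" "?b > 0" "?a \<le> ?b" "?b < u"
      using F_inv_pos F_inv_antimono[of "t - S" t] T ts assms by auto
    have "ln ?b - ln ?a \<le> L * S"
      using FL[OF ab(1,3,4)] F_F_inv ts by simp
    then have "ln ?b \<le> ln (exp (L * S) * ?a)"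
      using ab by (simp add: ln_mult)
    then show ?thesis using ab by simp
  qed
  then show ?thesis
    by (intro exI[of _ "exp (L * S)"] conjI eventually_at_top_linorderI[of "max (T + S) S"]) auto
qed

section \<open>Growth of \<open>f\<close> under dilations\<close>

text \<open>Since \<open>a < 1\<close>, all points \<open>a ^ n * y\<close> stay in (0, d), so the
  one-step estimate can be applied at each of them.\<close>

lemma iterated_lower_bound:
  assumes "\<And>y. 0 < y \<Longrightarrow> y < d \<Longrightarrow> c * f y \<le> f (a * y)" "0 < a" "a < 1" "0 \<le> c" "0 < y" "y < d"
  shows "c ^ n * f y \<le> f (a ^ n * y)"
proof (induction n)
  case (Suc n)
  have "a ^ n * y \<le> 1 * y"
    using assms by (intro mult_right_mono power_le_one) auto
  then have "a ^ n * y < d" using \<open>y < d\<close> by simp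
  then have "c * f (a ^ n * y) \<le> f (a * (a ^ n * y))"
    using assms by (intro assms(1)) auto
  then show ?case
    using mult_left_mono[OF Suc \<open>0 \<le> c\<close>] by (simp add: mult.assoc)
qed simp

lemma iterated_upper_bound:
  assumes "\<And>y. 0 < y \<Longrightarrow> y < d \<Longrightarrow> f (a * y) \<le> c * f y" "0 < a" "a < 1" "0 \<le> c" "0 < y" "y < d"
  shows "f (a ^ n * y) \<le> c ^ n * f y"
proof (induction n)
  case (Suc n)
  have "a ^ n * y \<le> 1 * y"
    using assms by (intro mult_right_mono power_le_one) auto
  then have "a ^ n * y < d" using \<open>y < d\<close> by simp
  then have "f (a * (a ^ n * y)) \<le> c * f (a ^ n * y)"
    using assms by (intro assms(1)) auto
  then show ?case
    using mult_left_mono[OF Suc \<open>0 \<le> c\<close>] by (simp add: mult.assoc)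
qed simp

text \<open>A lower bound on \<open>f\<close> under a contraction, iterated and read backwards, is
  an upper bound under an expansion. It turns |x| \<le> K \<phi> into a bound of |f(x)| by a
  multiple of f(\<phi>).\<close>

lemma dilation_bound:
  assumes \<epsilon>: "0 < \<epsilon>" "\<epsilon> < 1" and Phi: "Phi_lower f \<epsilon> > 0" and "K \<ge> 0"
  shows "\<exists>d>0. \<exists>C>0. \<forall>y. 0 < y \<and> y < d \<longrightarrow> f (K * y) \<le> C * f y"
proof -
  obtain c where c: "0 < c" "ereal c < Phi_lower f \<epsilon>"
    using ereal_dense2[OF Phi] by auto
  then have "\<forall>\<^sub>F y in at_right 0. ereal c < ereal (f ((1 - \<epsilon>) * y) / f y)"
    unfolding Phi_lower_def by (intro less_LiminfD)
  then obtain d where d: "d > 0" "\<And>y. 0 < y \<Longrightarrow> y < d \<Longrightarrow> c < f ((1 - \<epsilon>) * y) / f y"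
    by (auto simp: eventually_at_right_field)
  have step: "c * f y \<le> f ((1 - \<epsilon>) * y)" if "0 < y" "y < d" for y
    using d(2)[OF that] pos[OF that(1)] by (simp add: field_simps)
  \<comment> \<open>\<open>n\<close> contractions more than undo a dilation by \<open>K + 1\<close>.
    Using \<open>K + 1\<close> instead of \<open>K\<close> keeps the dilation factor positive when
    \<open>K = 0\<close>.\<close>
  obtain n where n: "(1 - \<epsilon>) ^ n < 1 / (K + 1)"
    using real_arch_pow_inv[of "1 / (K + 1)" "1 - \<epsilon>"] \<epsilon> \<open>K \<ge> 0\<close> by auto
  have "f (K * y) \<le> inverse (c ^ n) * f y" if y: "0 < y" "y < d / (K + 1)" for y
  proof -
    have Ky: "0 < (K + 1) * y" "(K + 1) * y < d"
      using y \<open>K \<ge> 0\<close> by (auto simp: pos_less_divide_eq mult.commute)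
    have "(1 - \<epsilon>) ^ n * ((K + 1) * y) \<le> (1 / (K + 1)) * ((K + 1) * y)"
      using n Ky by (intro mult_right_mono) auto
    then have small: "(1 - \<epsilon>) ^ n * ((K + 1) * y) \<le> y"
      using \<open>K \<ge> 0\<close> by simp
    have "c ^ n * f (K * y) \<le> c ^ n * f ((K + 1) * y)"
      using c y by (intro mult_left_mono monoD[OF mono]) (auto simp: algebra_simps)
    also have "\<dots> \<le> f ((1 - \<epsilon>) ^ n * ((K + 1) * y))"
      by (rule iterated_lower_bound[OF step]) (use \<epsilon> c Ky in auto)
    also have "\<dots> \<le> f y"
      using small by (rule monoD[OF mono])
    finally show ?thesis using c by (simp add: field_simps)
  qed
  moreover have "d / (K + 1) > 0" "inverse (c ^ n) > 0"
    using d c \<open>K \<ge> 0\<close> by auto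
  ultimately show ?thesis by blast
qed

text \<open>Halving the argument multiplies \<open>f\<close> by at most some q < 1/2, so
  \<open>n\<close> doublings multiply it by at least \<open>1 / q ^ n\<close>. This outgrows
  \<open>2 ^ n + K\<close>, which serves as \<open>M\<close>.\<close>

lemma superlinear_dilation:
  assumes limsup: "Limsup (at_right 0) (\<lambda>y. ereal (f (1 / 2 * y) / f y)) < ereal (1 / 2)" and "K \<ge> 0"
  shows "\<exists>d>0. \<exists>M>K. \<forall>y. 0 < y \<and> y < d \<longrightarrow> M * f y < f ((M - K) * y)"
proof -
  obtain q' where q': "Limsup (at_right 0) (\<lambda>y. ereal (f (1 / 2 * y) / f y)) < ereal q'" "q' < 1 / 2"
    using ereal_dense2[OF limsup] by auto
  \<comment> \<open>The maximum makes \<open>q\<close> positive, so that one can divide by it, and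
    keeps it below 1/2.\<close>
  define q where "q = max q' (1 / 4)"
  have q: "0 < q" "q < 1 / 2" using q' by (auto simp: q_def)
  have "\<forall>\<^sub>F y in at_right 0. ereal (f (1 / 2 * y) / f y) < ereal q'"
    using q'(1) by (rule Limsup_lessD)
  then obtain d where d: "d > 0" "\<And>y. 0 < y \<Longrightarrow> y < d \<Longrightarrow> f (1 / 2 * y) / f y < q'"
    by (auto simp: eventually_at_right_field)
  have step: "f (1 / 2 * y) \<le> q * f y" if "0 < y" "y < d" for y
  proof -
    have "f (1 / 2 * y) / f y \<le> q" using d(2)[OF that] by (simp add: q_def)
    then show ?thesis using pos[OF that(1)] by (simp only: pos_divide_le_eq)
  qed
  obtain n where n: "K + 1 < (1 / (2 * q)) ^ n"
    using real_arch_pow[of "1 / (2 * q)" "K + 1"] q by auto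
  have "2 ^ n + K \<le> 2 ^ n * (K + 1)"
    using \<open>K \<ge> 0\<close> mult_right_mono[of 1 "2 ^ n" K] by (simp add: algebra_simps)
  also have "\<dots> < 2 ^ n * (1 / (2 * q)) ^ n"
    using n by simp
  also have "\<dots> = 1 / q ^ n"
    by (simp add: power_mult_distrib power_divide)
  finally have nq: "2 ^ n + K < 1 / q ^ n" .
  have "(2 ^ n + K) * f y < f ((2 ^ n + K - K) * y)" if y: "0 < y" "y < d / 2 ^ n" for y
  proof -
    have "f ((1 / 2) ^ n * (2 ^ n * y)) \<le> q ^ n * f (2 ^ n * y)"
      by (rule iterated_upper_bound[OF step]) (use q y in \<open>auto simp: field_simps\<close>)
    then have "1 / q ^ n * f y \<le> f (2 ^ n * y)"
      using q by (simp add: field_simps power_divide)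
    moreover have "(2 ^ n + K) * f y < 1 / q ^ n * f y"
      using nq pos[OF y(1)] by (rule mult_strict_right_mono)
    ultimately show ?thesis by simp
  qed
  moreover have "d / 2 ^ n > 0" "2 ^ n + K > K" using d by auto
  ultimately show ?thesis by blast
qed

section \<open>Comparison with a delayed barrier\<close>

lemma perturbed_upper_bound:
  fixes z G :: "real \<Rightarrow> real"
  assumes limsup: "Limsup (at_right 0) (\<lambda>y. ereal (f (1 / 2 * y) / f y)) < ereal (1 / 2)"
    and G: "\<forall>\<^sub>F t in at_top. \<bar>G t\<bar> \<le> K * F_inv f t" and "K \<ge> 0"
    and z_deriv: "\<And>t. t > 0 \<Longrightarrow> (z has_real_derivative - f (z t - G t)) (at t)"
    and z_lim: "(z \<longlongrightarrow> 0) at_top"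
  shows "\<exists>C\<ge>0. \<forall>\<^sub>F t in at_top. z t \<le> C * F_inv f t"
proof -
  obtain d M where d: "d > 0" and M: "M > K"
    and dM: "\<And>y. 0 < y \<Longrightarrow> y < d \<Longrightarrow> M * f y < f ((M - K) * y)"
    using superlinear_dilation[OF limsup \<open>K \<ge> 0\<close>] by blast
  obtain \<tau>' where \<tau>': "\<And>t. t \<ge> \<tau>' \<Longrightarrow> F_inv f t < d"
    using order_tendstoD(2)[OF F_inv_tendsto d] by (auto simp: eventually_at_top_linorder)
  define \<tau> where "\<tau> = max 1 \<tau>'"
  have \<tau>: "\<tau> > 0" "\<And>t. t \<ge> \<tau> \<Longrightarrow> F_inv f t < d" using \<tau>' by (auto simp: \<tau>_def)
  \<comment> \<open>The level is fixed before the starting time \<open>T\<close>: as it is positive,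
    \<open>z\<close> eventually falls below it.\<close>
  have "M * F_inv f \<tau> > 0" using M \<open>K \<ge> 0\<close> F_inv_pos[of \<tau>] \<tau> by simp
  then have "\<forall>\<^sub>F t in at_top. z t < M * F_inv f \<tau>" by (rule order_tendstoD(2)[OF z_lim])
  then have "\<forall>\<^sub>F t in at_top. z t < M * F_inv f \<tau> \<and> \<bar>G t\<bar> \<le> K * F_inv f t"
    using G by (rule eventually_conj)
  then obtain T' where T': "\<And>t. t \<ge> T' \<Longrightarrow> z t < M * F_inv f \<tau> \<and> \<bar>G t\<bar> \<le> K * F_inv f t"
    by (auto simp: eventually_at_top_linorder)
  define T where "T = max \<tau> T'"
  define S where "S = T - \<tau>"
  have T: "T > 0" "S \<ge> 0" "z T < M * F_inv f \<tau>" "\<And>t. t \<ge> T \<Longrightarrow> \<bar>G t\<bar> \<le> K * F_inv f t"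
    using T' \<tau> by (auto simp: T_def S_def)
  \<comment> \<open>The time shift lets the barrier start at \<open>M * F_inv f \<tau>\<close>, where \<open>dM\<close> applies, without changing its order of decay.\<close>
  define u where "u t = z t - M * F_inv f (t - S)" for t
  have u_deriv: "(u has_real_derivative - f (z t - G t) + M * f (F_inv f (t - S))) (at t)"
    if "t \<ge> T" for t
  proof -
    have "((\<lambda>t. F_inv f (t - S)) has_real_derivative - f (F_inv f (t - S)) * 1) (at t)"
      by (rule DERIV_chain2[where f = "F_inv f"]) (use that \<tau> in \<open>auto intro!: F_inv_deriv derivative_eq_intros simp: S_def\<close>)
    then show ?thesis
      unfolding u_def using z_deriv[of t] that T(1) by (auto intro!: derivative_eq_intros)
  qed
  have "u t < 0" if "t \<ge> T" for t
  proof (rule first_crossing[OF _ _ _ that])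
    show "continuous_on {T..} u"
      using u_deriv by (intro continuous_at_imp_continuous_on) (auto intro: DERIV_isCont)
    show "u T < 0" using T(3) by (simp add: u_def S_def)
    fix t assume t: "t > T" "u t = 0"
    \<comment> \<open>At contact \<open>z t = M * ?p\<close>. Since \<phi> decreases, the bound on
      \<open>G t\<close> passes to \<open>K * ?p\<close>, so \<open>z t - G t\<close> is at least
      \<open>(M - K) * ?p\<close>, and \<open>dM\<close> makes the derivative of \<open>u\<close>
      negative.\<close>
    let ?p = "F_inv f (t - S)"
    have ts: "t - S \<ge> \<tau>" using t by (simp add: S_def)
    have p: "0 < ?p" "?p < d" using F_inv_pos[of "t - S"] \<tau> ts by auto
    have "\<bar>G t\<bar> \<le> K * F_inv f t" using T t by simp
    also have "\<dots> \<le> K * ?p"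
      using \<open>K \<ge> 0\<close> ts \<tau> T(2) by (intro mult_left_mono F_inv_antimono) auto
    finally have "(M - K) * ?p \<le> z t - G t"
      using t(2) by (simp add: u_def algebra_simps)
    then have "M * f ?p < f (z t - G t)"
      using dM[OF p] monoD[OF mono] by fastforce
    then show "\<exists>D<0. (u has_real_derivative D) (at t)"
      using u_deriv[of t] t by (intro exI[of _ "- f (z t - G t) + M * f ?p"]) auto
  qed
  then have zt: "\<forall>\<^sub>F t in at_top. z t \<le> M * F_inv f (t - S)"
    by (intro eventually_at_top_linorderI[of T]) (auto simp: u_def less_imp_le)
  obtain C where C: "C \<ge> 0" "\<forall>\<^sub>F t in at_top. F_inv f (t - S) \<le> C * F_inv f t"
    using F_inv_shift[OF T(2)] by blast
  have "\<forall>\<^sub>F t in at_top. z t \<le> (M * C) * F_inv f t"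
    using zt C(2)
  proof eventually_elim
    case (elim t)
    have "M * F_inv f (t - S) \<le> M * (C * F_inv f t)"
      using elim(2) M \<open>K \<ge> 0\<close> by (intro mult_left_mono) auto
    then show ?case using elim(1) by simp
  qed
  moreover have "M * C \<ge> 0" using M \<open>K \<ge> 0\<close> C by simp
  ultimately show ?thesis by blast
qed

lemma perturbed_bound:
  fixes z G :: "real \<Rightarrow> real"
  assumes limsup: "Limsup (at_right 0) (\<lambda>y. ereal (f (1 / 2 * y) / f y)) < ereal (1 / 2)"
    and G: "G \<in> O[at_top](F_inv f)"
    and z_deriv: "\<And>t. t > 0 \<Longrightarrow> (z has_real_derivative - f (z t - G t)) (at t)"
    and z_lim: "(z \<longlongrightarrow> 0) at_top"
  shows "z \<in> O[at_top](F_inv f)"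
proof -
  have F_inv_ev: "\<forall>\<^sub>F t in at_top. F_inv f t > 0"
    using F_inv_pos by (intro eventually_at_top_linorderI[of 0])
  obtain K where K: "K > 0" "\<forall>\<^sub>F t in at_top. norm (G t) \<le> K * norm (F_inv f t)"
    using landau_o.bigE[OF G] by blast
  have G': "\<forall>\<^sub>F t in at_top. \<bar>G t\<bar> \<le> K * F_inv f t"
    using K(2) F_inv_ev by eventually_elim auto
  obtain C1 where C1: "C1 \<ge> 0" "\<forall>\<^sub>F t in at_top. z t \<le> C1 * F_inv f t"
    using perturbed_upper_bound[OF limsup G' _ z_deriv z_lim] K by auto
  \<comment> \<open>As \<open>f\<close> is odd, \<open>- z\<close> solves the same equation with
    \<open>- G\<close> in place of \<open>G\<close>.\<close>
  have "\<exists>C\<ge>0. \<forall>\<^sub>F t in at_top. - z t \<le> C * F_inv f t"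
  proof (rule perturbed_upper_bound[OF limsup])
    show "\<forall>\<^sub>F t in at_top. \<bar>- G t\<bar> \<le> K * F_inv f t" "K \<ge> 0" using G' K by auto
    show "((\<lambda>t. - z t) \<longlongrightarrow> 0) at_top" using tendsto_minus[OF z_lim] by simp
    show "((\<lambda>t. - z t) has_real_derivative - f (- z t - - G t)) (at t)" if "t > 0" for t
      using DERIV_minus[OF z_deriv[OF that]] odd[of "z t - G t"] by simp
  qed
  then obtain C2 where C2: "C2 \<ge> 0" "\<forall>\<^sub>F t in at_top. - z t \<le> C2 * F_inv f t"
    by blast
  show ?thesis
  proof (rule bigoI[of _ "C1 + C2"])
    show "\<forall>\<^sub>F t in at_top. norm (z t) \<le> (C1 + C2) * norm (F_inv f t)"
      using C1(2) C2(2) F_inv_ev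
    proof eventually_elim
      case (elim t)
      have "C1 * F_inv f t \<ge> 0" "C2 * F_inv f t \<ge> 0" using C1 C2 elim by auto
      then show ?case using elim by (simp add: algebra_simps abs_le_iff)
    qed
  qed
qed

section \<open>Integrating a derivative bound\<close>

text \<open>Because \<phi>' = - f(\<phi>), the function y + C \<phi> is nonincreasing and y - C
  \<phi> is nondecreasing. They differ by 2 C \<phi>, which tends to 0, and so enclose a common
  limit.\<close>

lemma convergent_of_deriv_bound:
  fixes y y' :: "real \<Rightarrow> real"
  assumes "T > 0" "C \<ge> 0"
    and deriv: "\<And>t. t \<ge> T \<Longrightarrow> (y has_real_derivative y' t) (at t)"
    and bound: "\<And>t. t \<ge> T \<Longrightarrow> \<bar>y' t\<bar> \<le> C * f (F_inv f t)"
  shows "\<exists>L. (y \<longlongrightarrow> L) at_top \<and> (\<forall>t\<ge>T. \<bar>L - y t\<bar> \<le> C * F_inv f t)"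
proof -
  have deriv': "((\<lambda>t. y t + c * F_inv f t) has_real_derivative y' t - c * f (F_inv f t)) (at t)"
    if "t \<ge> T" for t c
    using deriv[OF that] F_inv_deriv[of t] that \<open>T > 0\<close> by (auto intro!: derivative_eq_intros)
  have dec: "y b + C * F_inv f b \<le> y a + C * F_inv f a" if "T \<le> a" "a \<le> b" for a b
  proof (rule DERIV_nonpos_imp_nonincreasing[OF that(2)])
    fix t assume "a \<le> t" "t \<le> b"
    then show "\<exists>D. ((\<lambda>t. y t + C * F_inv f t) has_real_derivative D) (at t) \<and> D \<le> 0"
      using deriv'[of t C] bound[of t] that by (intro exI conjI) auto
  qed
  have inc: "y a - C * F_inv f a \<le> y b - C * F_inv f b" if "T \<le> a" "a \<le> b" for a b
  proof -
    have "y a + - C * F_inv f a \<le> y b + - C * F_inv f b"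
    proof (rule DERIV_nonneg_imp_nondecreasing[OF that(2)])
      fix t assume "a \<le> t" "t \<le> b"
      then show "\<exists>D. ((\<lambda>t. y t + - C * F_inv f t) has_real_derivative D) (at t) \<and> D \<ge> 0"
        using deriv'[of t "- C"] bound[of t] that by (intro exI conjI) auto
    qed
    then show ?thesis by simp
  qed
  have nonneg: "C * F_inv f t \<ge> 0" if "t \<ge> T" for t
    using F_inv_pos[of t] that assms(1,2) by simp
  define L where "L = (SUP t\<in>{T..}. y t - C * F_inv f t)"
  \<comment> \<open>The times are independent: each lower value lies below every upper value, so the
    supremum \<open>L\<close> is finite and lies below all upper values.\<close>
  have bd: "y a - C * F_inv f a \<le> y b + C * F_inv f b" if "a \<ge> T" "b \<ge> T" for a b
  proof (cases "a \<le> b")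
    case True
    then show ?thesis using inc[of a b] nonneg[of b] that by simp
  next
    case False
    then show ?thesis using dec[of b a] nonneg[of a] that by simp
  qed
  have lo: "y t - C * F_inv f t \<le> L" if "t \<ge> T" for t
    unfolding L_def using that bd[of _ T] by (intro cSUP_upper bdd_aboveI2) auto
  have hi: "L \<le> y t + C * F_inv f t" if "t \<ge> T" for t
    unfolding L_def using that bd by (intro cSUP_least) auto
  have close: "\<bar>L - y t\<bar> \<le> C * F_inv f t" if "t \<ge> T" for t
    using lo[OF that] hi[OF that] by (simp add: abs_le_iff)
  have "((\<lambda>t. y t - L) \<longlongrightarrow> 0) at_top"
  proof (rule Lim_null_comparison)
    show "\<forall>\<^sub>F t in at_top. norm (y t - L) \<le> C * F_inv f t"
      using close by (intro eventually_at_top_linorderI[of T]) (simp add: abs_minus_commute)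
    show "((\<lambda>t. C * F_inv f t) \<longlongrightarrow> 0) at_top"
      using tendsto_mult_left[OF F_inv_tendsto, of C] by simp
  qed
  then have "(y \<longlongrightarrow> L) at_top" by (simp add: LIM_zero_iff)
  with close show ?thesis by blast
qed

end

section \<open>The equivalence\<close>

theorem theorem2:
  fixes f g x :: "real \<Rightarrow> real" and \<xi> :: real
  assumes f_lipschitz: "local_lipschitz (UNIV :: real set) UNIV (\<lambda>_. f)"
    and f_mono: "mono f"
    and f_odd: "\<And>y. f (- y) = - f y"
    and f_zero: "f 0 = 0"
    and f_sign: "\<And>y. y \<noteq> 0 \<Longrightarrow> y * f y > 0"
    and Phi_pos: "\<exists>\<epsilon>0\<in>{0<..<1::real}. \<forall>\<epsilon>\<in>{0<..<\<epsilon>0}. Phi_lower f \<epsilon> > 0"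
    and Phi_lim: "(Phi_lower f \<longlongrightarrow> 1) (at_right 0)"
    and f_limsup: "\<And>\<mu>::real. \<mu> \<in> {0<..<1} \<Longrightarrow>
                     Limsup (at_right 0) (\<lambda>y. ereal (f (\<mu> * y) / f y)) < ereal \<mu>"
    and g_cont: "continuous_on {0..} g"
    and x_cont: "continuous_on {0..} x"
    and x_deriv: "\<And>t. t > 0 \<Longrightarrow> (x has_real_derivative (- f (x t) + g t)) (at t)"
    and x_init: "x 0 = \<xi>"
    and x_lim: "(x \<longlongrightarrow> 0) at_top"
  shows "((\<exists>L. ((\<lambda>t. LBINT s=ereal 0..ereal t. g s) \<longlongrightarrow> L) at_top)
            \<and> improper_integral_from g \<in> O[at_top](F_inv f))
         \<longleftrightarrow> x \<in> O[at_top](F_inv f)"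
proof -
  interpret damping f
  proof
    show "0 < f y" if "y > 0" for y
      using f_sign[of y] that by (simp add: zero_less_mult_iff)
  qed (fact f_lipschitz f_mono f_odd)+
  define H where "H t = (LBINT s=ereal 0..ereal t. g s)" for t
  have H_deriv: "(H has_real_derivative g t) (at t)" if "t > 0" for t
    unfolding H_def using integral_deriv[OF g_cont that] .
  have tail: "\<forall>\<^sub>F t in at_top. improper_integral_from g t = L - H t"
    if "(H \<longlongrightarrow> L) at_top" for L
    using improper_integral_from_eq[OF g_cont, of L] that
    by (intro eventually_at_top_linorderI[of 0]) (simp add: H_def[abs_def])
  have limsup: "Limsup (at_right 0) (\<lambda>y. ereal (f (1 / 2 * y) / f y)) < ereal (1 / 2)"
    using f_limsup[of "1 / 2"] by simp
  have "x \<in> O[at_top](F_inv f)"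
    if L: "(H \<longlongrightarrow> L) at_top" and O: "improper_integral_from g \<in> O[at_top](F_inv f)" for L
  proof -
    have G: "(\<lambda>t. L - H t) \<in> O[at_top](F_inv f)"
      using O landau_o.big.in_cong[OF tail[OF L]] by blast
    \<comment> \<open>The derivative \<open>- g t\<close> of the tail cancels the forcing, so the
      sum solves the perturbed equation; subtracting the tail then recovers
      \<open>x\<close>.\<close>
    have "(\<lambda>t. x t + (L - H t)) \<in> O[at_top](F_inv f)"
    proof (rule perturbed_bound[OF limsup G])
      show "((\<lambda>t. x t + (L - H t)) has_real_derivative - f (x t + (L - H t) - (L - H t))) (at t)"
        if "t > 0" for t
        using x_deriv[OF that] H_deriv[OF that] by (auto intro!: derivative_eq_intros)
      show "((\<lambda>t. x t + (L - H t)) \<longlongrightarrow> 0) at_top"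
        using tendsto_add[OF x_lim tendsto_diff[OF tendsto_const L, of L]] by simp
    qed
    from sum_in_bigo(2)[OF this G] show ?thesis by simp
  qed
  \<comment> \<open>From (b) to (a): \<open>H - x\<close> has derivative \<open>f (x t)\<close>,
    which the dilation bound controls by f(\<phi>). Hence \<open>H - x\<close> converges at rate
    \<phi>, and \<open>H\<close> has the same limit because \<open>x\<close> tends to 0.\<close>
  moreover have "\<exists>L. (H \<longlongrightarrow> L) at_top \<and> improper_integral_from g \<in> O[at_top](F_inv f)"
    if O: "x \<in> O[at_top](F_inv f)"
  proof -
    obtain K where K: "K > 0" "\<forall>\<^sub>F t in at_top. norm (x t) \<le> K * norm (F_inv f t)"
      using landau_o.bigE[OF O] by blast
    obtain \<epsilon>0 where \<epsilon>0: "0 < \<epsilon>0" "\<epsilon>0 < 1" "\<And>\<epsilon>. \<epsilon> \<in> {0<..<\<epsilon>0} \<Longrightarrow> Phi_lower f \<epsilon> > 0"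
      using Phi_pos by auto
    obtain d C where d: "d > 0" and C: "C > 0"
      and dC: "\<And>y. 0 < y \<Longrightarrow> y < d \<Longrightarrow> f (K * y) \<le> C * f y"
      using dilation_bound[of "\<epsilon>0 / 2" K] \<epsilon>0 K by auto
    have "\<forall>\<^sub>F t in at_top. \<bar>x t\<bar> \<le> K * \<bar>F_inv f t\<bar> \<and> F_inv f t < d"
      using K(2) order_tendstoD(2)[OF F_inv_tendsto d] by eventually_elim simp
    then obtain T' where T': "\<And>t. t \<ge> T' \<Longrightarrow> \<bar>x t\<bar> \<le> K * \<bar>F_inv f t\<bar> \<and> F_inv f t < d"
      by (auto simp: eventually_at_top_linorder)
    define T where "T = max 1 T'"
    have T: "T > 0" by (simp add: T_def)
    have bound: "\<bar>f (x t)\<bar> \<le> C * f (F_inv f t)" if "t \<ge> T" for t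
    proof -
      have t: "F_inv f t > 0" "F_inv f t < d" "\<bar>x t\<bar> \<le> K * F_inv f t"
        using F_inv_pos[of t] T'[of t] that by (auto simp: T_def)
      have "\<bar>f (x t)\<bar> \<le> f (K * F_inv f t)"
        unfolding abs_eq using t(3) by (rule monoD[OF f_mono])
      with dC[OF t(1,2)] show ?thesis by simp
    qed
    have "\<exists>L. ((\<lambda>t. H t - x t) \<longlongrightarrow> L) at_top \<and> (\<forall>t\<ge>T. \<bar>L - (H t - x t)\<bar> \<le> C * F_inv f t)"
    proof (rule convergent_of_deriv_bound[OF T _ _ bound])
      show "((\<lambda>t. H t - x t) has_real_derivative f (x t)) (at t)" if "t \<ge> T" for t
        using x_deriv[of t] H_deriv[of t] that T by (auto intro!: derivative_eq_intros)
    qed (use C in auto)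
    then obtain L where L: "((\<lambda>t. H t - x t) \<longlongrightarrow> L) at_top"
      and close: "\<And>t. t \<ge> T \<Longrightarrow> \<bar>L - (H t - x t)\<bar> \<le> C * F_inv f t"
      by blast
    have HL: "(H \<longlongrightarrow> L) at_top"
      using tendsto_add[OF L x_lim] by simp
    have "(\<lambda>t. L - (H t - x t)) \<in> O[at_top](F_inv f)"
    proof (rule bigoI[of _ C], rule eventually_at_top_linorderI[of T])
      fix t assume "t \<ge> T"
      then show "norm (L - (H t - x t)) \<le> C * norm (F_inv f t)"
        using close[of t] F_inv_pos[of t] T by simp
    qed
    \<comment> \<open>The tail \<open>L - H t\<close> is the difference of
      \<open>L - (H t - x t)\<close> and \<open>x t\<close>, both of order \<phi>.\<close>
    from sum_in_bigo(2)[OF this O] have "(\<lambda>t. L - H t) \<in> O[at_top](F_inv f)"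
      by (simp add: algebra_simps)
    then have "improper_integral_from g \<in> O[at_top](F_inv f)"
      using landau_o.big.in_cong[OF tail[OF HL]] by blast
    with HL show ?thesis by blast
  qed
  ultimately show ?thesis unfolding H_def[symmetric] by blast
qed

end
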